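(* Let $X$ be a Euclidean space, $f:X\to\mathbb{R}$ continuous, $B:=\operatorname{gra} f=\{(y,f(y)):y\in X\}\subset X\times\mathbb{R}$ and $A:=X\times\{0\}$. Let $D\subset X$ be nonempty and convex, and let $F:D\to\,]-\infty,+\infty]$ be convex and such that for all $y\in D$ $$\partial F(y)\supset\begin{cases}\left\{\frac{f(y)}{\|y^*\|^2}y^* : y^*\in\partial^0 f(y)\right\} & \text{if } 0\notin\partial^0 f(y),\\ \{0\} & \text{if } f(y)=0.\end{cases}$$ Let $V:D\times\mathbb{R}\to[-\infty,+\infty]$, $V(y,\rho):=F(y)+\tfrac12\rho^2$. Let $x=(y,0)\in D\times\mathbb{R}$ and $0\notin\partial^0 f(y)$. Let $\mathcal{N}$ be the Newton--Raphson method. The following hold. (i) If $X=\mathbb{R}$ and $f$ is differentiable, then $(\mathcal{N}(y),0)=x-\nabla V(x)$. (ii) Otherwise, let $y^*\in\partial^0 f(y)$, and we have $$\left(y-\frac{f(y)}{\|y^*\|^2}y^*,\,0\right)=x-x^*\quad\text{for some } x^*\in\partial V(x).$$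
   Context: Euclidean space means finite-dimensional real inner product space. The Newton--Raphson update for $f$ is $\mathcal{N}(y):=y-\frac{f(y)}{f'(y)}$. $\partial f$ denotes the limiting (Mordukhovich) subdifferential and $\partial^0 f(y):=\partial f(y)\cup(-\partial(-f)(y))$ the symmetric subdifferential. For the convex functions $F$ and $V$, $\partial$ is the usual convex subdifferential; $\nabla V$ is the gradient of $V$. *)

theory Defs
  imports "HOL-Analysis.Analysis"
begin

definition regular_subdiff :: "('a::euclidean_space \<Rightarrow> real) \<Rightarrow> 'a \<Rightarrow> 'a set" where
  "regular_subdiff f x =
     {v. 0 \<le> Liminf (at x) (\<lambda>z. ereal ((f z - f x - v \<bullet> (z - x)) / norm (z - x)))}"

definition limiting_subdiff :: "('a::euclidean_space \<Rightarrow> real) \<Rightarrow> 'a \<Rightarrow> 'a set" where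
  "limiting_subdiff f x =
     {v. \<exists>xs vs. xs \<longlonglongrightarrow> x \<and> (\<lambda>n. f (xs n)) \<longlonglongrightarrow> f x \<and>
                 (\<forall>n. vs n \<in> regular_subdiff f (xs n)) \<and> vs \<longlonglongrightarrow> v}"

definition symmetric_subdiff :: "('a::euclidean_space \<Rightarrow> real) \<Rightarrow> 'a \<Rightarrow> 'a set" where
  "symmetric_subdiff f x = limiting_subdiff f x \<union> uminus ` limiting_subdiff (\<lambda>z. - f z) x"

text \<open>A function from a set \<open>S\<close> to the extended reals is a total function of which only the
  values on \<open>S\<close> matter; equivalently, it is read as \<open>\<infinity>\<close> off \<open>S\<close>.\<close>

definition ereal_convex_on :: "'b::real_vector set \<Rightarrow> ('b \<Rightarrow> ereal) \<Rightarrow> bool" where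
  "ereal_convex_on S G \<longleftrightarrow> convex S \<and>
     (\<forall>x\<in>S. \<forall>z\<in>S. \<forall>t. 0 < t \<and> t < 1 \<longrightarrow>
        G ((1 - t) *\<^sub>R x + t *\<^sub>R z) \<le> ereal (1 - t) * G x + ereal t * G z)"

text \<open>Finiteness at the base point makes the subdifferential empty outside the effective domain,
  also for the function that is constantly \<open>\<infinity>\<close>.\<close>

definition convex_subdiff :: "'b::real_inner set \<Rightarrow> ('b \<Rightarrow> ereal) \<Rightarrow> 'b \<Rightarrow> 'b set" where
  "convex_subdiff S G x =
     {v. \<bar>G x\<bar> \<noteq> \<infinity> \<and> (\<forall>z\<in>S. G x + ereal (v \<bullet> (z - x)) \<le> G z)}"

text \<open>The gradient is relative to the domain \<open>S\<close> of the function, so that it also makes sense at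
  boundary points of \<open>S\<close>; at interior points it is the ordinary gradient, because there
  \<open>at x within S = at x\<close>. Since \<open>real_of_ereal\<close> sends infinite values to \<open>0\<close>, finiteness near
  \<open>x\<close> has to be required.\<close>

definition has_gradient_within ::
    "('b::real_inner \<Rightarrow> ereal) \<Rightarrow> 'b \<Rightarrow> 'b \<Rightarrow> 'b set \<Rightarrow> bool" where
  "has_gradient_within G v x S \<longleftrightarrow>
     \<bar>G x\<bar> \<noteq> \<infinity> \<and> (\<forall>\<^sub>F z in at x within S. \<bar>G z\<bar> \<noteq> \<infinity>) \<and>
     ((\<lambda>z. real_of_ereal (G z)) has_derivative (\<lambda>h. v \<bullet> h)) (at x within S)"

definition newton_raphson :: "(real \<Rightarrow> real) \<Rightarrow> real \<Rightarrow> real" where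
  "newton_raphson f y = y - f y / deriv f y"

definition newton_potential ::
    "('a::euclidean_space \<Rightarrow> real) \<Rightarrow> 'a set \<Rightarrow> ('a \<Rightarrow> ereal) \<Rightarrow> bool" where
  "newton_potential f D F \<longleftrightarrow>
     D \<noteq> {} \<and> convex D \<and> (\<forall>y\<in>D. F y \<noteq> -\<infinity>) \<and> ereal_convex_on D F \<and>
     (\<forall>y\<in>D.
        (0 \<notin> symmetric_subdiff f y \<longrightarrow>
           {(f y / (norm ys)\<^sup>2) *\<^sub>R ys | ys. ys \<in> symmetric_subdiff f y} \<subseteq> convex_subdiff D F y) \<and>
        (f y = 0 \<longrightarrow> {0} \<subseteq> convex_subdiff D F y))"

definition lyapunov_fun :: "('a \<Rightarrow> ereal) \<Rightarrow> 'a \<times> real \<Rightarrow> ereal" where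
  "lyapunov_fun F = (\<lambda>(y, \<rho>). F y + ereal (\<rho>\<^sup>2 / 2))"

end

theory Submission
  imports Defs
begin

text \<open>The second claim is separability of \<open>V\<close>. For the first, \<open>0 \<notin> \<partial>\<^sup>0f(y)\<close> keeps
  \<open>f'\<close> away from \<open>0\<close> near \<open>y\<close>, so that \<open>g = f/f'\<close> is a selection of \<open>\<partial>F\<close> on
  \<open>D\<close> near \<open>y\<close>, hence nondecreasing. The difference quotients of \<open>f\<close> at \<open>y\<close> are values \<open>f'(\<xi>)\<close>
  with \<open>\<xi>\<close> between \<open>y\<close> and \<open>z\<close>, hence \<open>g(\<xi>) \<rightarrow> g(y)\<close> along these points even though \<open>f'\<close> need not
  be continuous. Monotonicity turns this into continuity of \<open>g\<close> at \<open>y\<close> within \<open>D\<close>, and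
  a continuous selection of \<open>\<partial>F\<close> is the derivative of \<open>F\<close>.\<close>

section \<open>Subdifferentials of a differentiable function on the real line\<close>

text \<open>To the right of \<open>x\<close> the quotient tends to \<open>d - v\<close>, to the left
  to \<open>v - d\<close>. A nonnegative lower limit makes both nonnegative, and this leaves only
  \<open>v = d\<close>.\<close>

lemma regular_subdiff_real:
  fixes f :: "real \<Rightarrow> real"
  assumes f: "(f has_real_derivative d) (at x)"
  shows "regular_subdiff f x = {d}"
proof -
  let ?q = "\<lambda>z. (f z - f x) / (z - x)"
  have q: "(?q \<longlongrightarrow> d) (at x)"
    using f by (simp add: has_field_derivative_iff)
  have "v = d" if v: "v \<in> regular_subdiff f x" for v
  proof -
    have ev: "\<forall>\<^sub>F z in at x. - e < (f z - f x - v * (z - x)) / \<bar>z - x\<bar>" if "e > 0" for e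
    proof -
      have "ereal (- e) < 0"
        using that by simp
      then show ?thesis
        using v unfolding regular_subdiff_def
        by (auto simp: le_Liminf_iff dest!: spec[of _ "ereal (- e)"])
    qed
    have r: "- e \<le> d - v" if "e > 0" for e
    proof (rule tendsto_lowerbound)
      show "((\<lambda>z. ?q z - v) \<longlongrightarrow> d - v) (at_right x)"
        by (intro tendsto_intros tendsto_within_subset[OF q]) auto
      have "\<forall>\<^sub>F z in at_right x. - e < (f z - f x - v * (z - x)) / \<bar>z - x\<bar>"
        using ev[OF that] by (simp add: eventually_at_split)
      moreover have "\<forall>\<^sub>F z in at_right x. z > x"
        by (simp add: eventually_at_right_less)
      ultimately show "\<forall>\<^sub>F z in at_right x. - e \<le> ?q z - v"
        by eventually_elim (simp add: field_simps)
    qed simp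
    have l: "- e \<le> v - d" if "e > 0" for e
    proof (rule tendsto_lowerbound)
      show "((\<lambda>z. v - ?q z) \<longlongrightarrow> v - d) (at_left x)"
        by (intro tendsto_intros tendsto_within_subset[OF q]) auto
      have "\<forall>\<^sub>F z in at_left x. - e < (f z - f x - v * (z - x)) / \<bar>z - x\<bar>"
        using ev[OF that] by (simp add: eventually_at_split)
      moreover have "\<forall>\<^sub>F z in at_left x. z < x"
        by (auto simp: eventually_at_filter)
      ultimately show "\<forall>\<^sub>F z in at_left x. - e \<le> v - ?q z"
        by eventually_elim (simp add: field_simps)
    qed simp
    have "v \<le> d"
    proof (rule field_le_epsilon)
      show "v \<le> d + e" if "e > 0" for e
        using r[OF that] by simp
    qed
    moreover have "d \<le> v"
    proof (rule field_le_epsilon)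
      show "d \<le> v + e" if "e > 0" for e
        using l[OF that] by simp
    qed
    ultimately show ?thesis by simp
  qed
  moreover have "d \<in> regular_subdiff f x"
  proof -
    have "((\<lambda>z. (f z - f x - d * (z - x)) / \<bar>z - x\<bar>) \<longlongrightarrow> 0) (at x)"
    proof (rule Lim_null_comparison)
      show "((\<lambda>z. \<bar>?q z - d\<bar>) \<longlongrightarrow> 0) (at x)"
        using q by (simp add: LIM_zero tendsto_rabs_zero)
      have "\<bar>(f z - f x - d * (z - x)) / \<bar>z - x\<bar>\<bar> = \<bar>?q z - d\<bar>" if "z \<noteq> x" for z
      proof -
        have "(f z - f x - d * (z - x)) / (z - x) = ?q z - d"
          using that by (simp add: diff_divide_distrib)
        then show ?thesis by (metis abs_divide abs_idempotent)
      qed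
      then show "\<forall>\<^sub>F z in at x. norm ((f z - f x - d * (z - x)) / \<bar>z - x\<bar>) \<le> \<bar>?q z - d\<bar>"
        by (auto simp: eventually_at_filter)
    qed
    then have "((\<lambda>z. ereal ((f z - f x - d \<bullet> (z - x)) / norm (z - x))) \<longlongrightarrow> 0) (at x)"
      by (simp add: zero_ereal_def)
    then show ?thesis
      unfolding regular_subdiff_def by (simp add: lim_imp_Liminf)
  qed
  ultimately show ?thesis by blast
qed

text \<open>The regular subdifferentials along \<open>xs\<close> are singletons, so
  \<open>vs\<close> is determined by \<open>xs\<close>; continuity of \<open>f\<close> supplies the
  convergence of the function values.\<close>

lemma limiting_subdiff_real:
  fixes f :: "real \<Rightarrow> real"
  assumes f: "\<And>t. (f has_real_derivative f' t) (at t)"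
  shows "limiting_subdiff f x = {v. \<exists>xs. xs \<longlonglongrightarrow> x \<and> (\<lambda>n. f' (xs n)) \<longlonglongrightarrow> v}"
proof -
  have "(\<lambda>n. f (xs n)) \<longlonglongrightarrow> f x" if "xs \<longlonglongrightarrow> x" for xs :: "nat \<Rightarrow> real"
    using DERIV_isCont[OF f] that by (rule isCont_tendsto_compose)
  moreover have "(\<forall>n. vs n = f' (xs n)) \<longleftrightarrow> vs = (\<lambda>n. f' (xs n))" for vs xs :: "nat \<Rightarrow> real"
    by auto
  ultimately show ?thesis
    unfolding limiting_subdiff_def regular_subdiff_real[OF f] by auto
qed

text \<open>Limits of values of \<open>- f'\<close> are the negatives of limits of values of
  \<open>f'\<close>, so the two halves of the union coincide.\<close>

lemma symmetric_subdiff_real: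
  fixes f :: "real \<Rightarrow> real"
  assumes f: "\<And>t. (f has_real_derivative f' t) (at t)"
  shows "symmetric_subdiff f x = {v. \<exists>xs. xs \<longlonglongrightarrow> x \<and> (\<lambda>n. f' (xs n)) \<longlonglongrightarrow> v}"
proof -
  have "((\<lambda>z. - f z) has_real_derivative - f' t) (at t)" for t
    using f by (rule DERIV_minus)
  from limiting_subdiff_real[OF this] have
    "limiting_subdiff (\<lambda>z. - f z) x = {v. \<exists>xs. xs \<longlonglongrightarrow> x \<and> (\<lambda>n. - f' (xs n)) \<longlonglongrightarrow> v}" .
  also have "\<dots> = uminus ` {v. \<exists>xs. xs \<longlonglongrightarrow> x \<and> (\<lambda>n. f' (xs n)) \<longlonglongrightarrow> v}"
  proof -
    have "uminus ` A = {v. - v \<in> A}" for A :: "real set"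
      by force
    then show ?thesis
      by (simp add: tendsto_minus_cancel_left)
  qed
  finally show ?thesis
    unfolding symmetric_subdiff_def limiting_subdiff_real[OF f] by (simp add: image_image)
qed

text \<open>If 0 is not a limit of values of \<open>f'\<close> along sequences tending to
  \<open>y\<close>, then \<open>f'\<close> is bounded away from 0 on a ball around \<open>y\<close>.
  The ball is open, so the bound also governs sequences tending to any other point of it.\<close>

lemma eventually_zero_notin_symmetric_subdiff:
  fixes f :: "real \<Rightarrow> real"
  assumes f: "\<And>t. (f has_real_derivative f' t) (at t)"
    and y: "0 \<notin> symmetric_subdiff f y"
  shows "\<forall>\<^sub>F z in nhds y. 0 \<notin> symmetric_subdiff f z"
proof -
  \<comment> \<open>One constant serves as radius and as lower bound: if it failed for every
    \<open>inverse (Suc n)\<close>, the counterexamples would tend to \<open>y\<close> with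
    \<open>f'\<close> tending to 0.\<close>
  obtain c where c: "c > 0" "\<And>z. \<bar>z - y\<bar> < c \<Longrightarrow> \<bar>f' z\<bar> \<ge> c"
  proof (rule ccontr)
    assume "\<not> thesis"
    then have "\<forall>n. \<exists>z. \<bar>z - y\<bar> < inverse (Suc n) \<and> \<bar>f' z\<bar> < inverse (Suc n)"
      using that by (metis inverse_positive_iff_positive not_less of_nat_0_less_iff zero_less_Suc)
    then obtain xs where xs: "\<And>n. \<bar>xs n - y\<bar> < inverse (Suc n)" "\<And>n. \<bar>f' (xs n)\<bar> < inverse (Suc n)"
      by metis
    have "(\<lambda>n. xs n - y) \<longlonglongrightarrow> 0" "(\<lambda>n. f' (xs n)) \<longlonglongrightarrow> 0"
      using xs by (auto intro!: Lim_null_comparison[OF always_eventually LIMSEQ_inverse_real_of_nat]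
          less_imp_le)
    then show False
      using y unfolding symmetric_subdiff_real[OF f] by (auto simp: LIM_zero_iff)
  qed
  have "0 \<notin> symmetric_subdiff f z" if "z \<in> ball y c" for z
  proof
    assume "0 \<in> symmetric_subdiff f z"
    then obtain xs where xs: "xs \<longlonglongrightarrow> z" "(\<lambda>n. f' (xs n)) \<longlonglongrightarrow> 0"
      unfolding symmetric_subdiff_real[OF f] by auto
    have "\<forall>\<^sub>F n in sequentially. xs n \<in> ball y c"
      using that xs(1) by (intro topological_tendstoD) auto
    moreover have "\<forall>\<^sub>F n in sequentially. \<bar>f' (xs n)\<bar> < c"
      using tendstoD[OF xs(2) c(1)] by simp
    ultimately have "\<forall>\<^sub>F n in sequentially. False"
      by eventually_elim (use c(2) in \<open>auto simp: dist_real_def abs_minus_commute not_less[symmetric]\<close>)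
    then show False by simp
  qed
  then show ?thesis
    using c(1) by (auto simp: eventually_nhds intro!: exI[of _ "ball y c"])
qed

section \<open>Monotonicity and continuity of the Newton step\<close>

text \<open>Adding the two subgradient inequalities cancels the values of \<open>F\<close>, which
  are finite at both points by \<open>convex_subdiff_def\<close>.\<close>

lemma convex_subdiff_mono:
  fixes F :: "real \<Rightarrow> ereal"
  assumes "g \<in> convex_subdiff D F y" "h \<in> convex_subdiff D F z" "y \<in> D" "z \<in> D" "y < z"
  shows "g \<le> h"
proof -
  obtain a b where ab: "F y = ereal a" "F z = ereal b"
    using assms(1,2) by (auto simp: convex_subdiff_def)
  have "F y + ereal (g * (z - y)) \<le> F z" "F z + ereal (h * (y - z)) \<le> F y"
    using assms by (auto simp: convex_subdiff_def)
  then have "a + g * (z - y) \<le> b" "b + h * (y - z) \<le> a"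
    by (simp_all add: ab)
  then have "g * (z - y) \<le> h * (z - y)"
    by (simp add: algebra_simps)
  then show ?thesis
    using \<open>y < z\<close> by simp
qed

text \<open>Mean value points \<open>\<xi> z\<close> are places near \<open>y\<close> where
  \<open>f'\<close> is under control; monotonicity carries this over to all points of
  \<open>S\<close> between \<open>y\<close> and \<open>\<xi> z\<close>.\<close>

lemma continuous_newton_step:
  fixes f :: "real \<Rightarrow> real"
  assumes f: "\<And>t. (f has_real_derivative f' t) (at t)"
    and y: "f' y \<noteq> 0" "y \<in> S" and S: "convex S"
    and mono: "\<And>w z. w \<in> S \<Longrightarrow> z \<in> S \<Longrightarrow> w < z \<Longrightarrow> f w / f' w \<le> f z / f' z"
  shows "((\<lambda>z. f z / f' z) \<longlongrightarrow> f y / f' y) (at y within S)"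
proof (rule tendstoI)
  fix e :: real assume e: "e > 0"
  let ?g = "\<lambda>z. f z / f' z"
  have "\<exists>\<xi>. (y < \<xi> \<and> \<xi> < z \<or> z < \<xi> \<and> \<xi> < y) \<and> (f z - f y) / (z - y) = f' \<xi>"
    if "z \<noteq> y" for z
  proof (cases "y < z")
    case True
    from MVT2[OF this f] that show ?thesis by (auto simp: field_simps)
  next
    case False
    with that have "z < y" by simp
    from MVT2[OF this f] that show ?thesis by (fastforce simp: field_simps)
  qed
  then obtain \<xi> where \<xi>: "\<And>z. z \<noteq> y \<Longrightarrow> y < \<xi> z \<and> \<xi> z < z \<or> z < \<xi> z \<and> \<xi> z < y"
    and quot: "\<And>z. z \<noteq> y \<Longrightarrow> (f z - f y) / (z - y) = f' (\<xi> z)"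
    by metis
  have "((\<lambda>z. (f z - f y) / (z - y)) \<longlongrightarrow> f' y) (at y)"
    using f[of y] by (simp add: has_field_derivative_iff)
  then have f': "((\<lambda>z. f' (\<xi> z)) \<longlongrightarrow> f' y) (at y)"
    by (rule Lim_transform_eventually) (auto simp: eventually_at_filter quot)
  have "((\<lambda>z. \<xi> z - y) \<longlongrightarrow> 0) (at y)"
  proof (rule Lim_null_comparison)
    have "\<bar>\<xi> z - y\<bar> \<le> \<bar>z - y\<bar>" if "z \<noteq> y" for z
      using \<xi>[OF that] by auto
    then show "\<forall>\<^sub>F z in at y. norm (\<xi> z - y) \<le> \<bar>z - y\<bar>"
      by (auto simp: eventually_at_filter)
    show "((\<lambda>z. \<bar>z - y\<bar>) \<longlongrightarrow> 0) (at y)"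
      by (auto intro!: tendsto_eq_intros)
  qed
  then have "((\<lambda>z. f (\<xi> z)) \<longlongrightarrow> f y) (at y)"
    by (intro isCont_tendsto_compose[OF DERIV_isCont[OF f]]) (simp add: LIM_zero_iff)
  then have "((\<lambda>z. ?g (\<xi> z)) \<longlongrightarrow> ?g y) (at y)"
    using f' y(1) by (rule tendsto_divide)
  then obtain d where d: "d > 0"
    "\<And>z. z \<noteq> y \<Longrightarrow> \<bar>z - y\<bar> < d \<Longrightarrow> \<bar>?g (\<xi> z) - ?g y\<bar> < e"
    using e by (auto simp: tendsto_iff eventually_at dist_real_def)
  \<comment> \<open>Monotonicity is available on \<open>S\<close> only; convexity of
    \<open>S\<close> keeps the mean value points inside.\<close>
  have \<xi>S: "\<xi> z \<in> S" if "z \<in> S" "z \<noteq> y" for z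
    using \<xi>[OF that(2)] that(1) y(2) S
    by (auto simp: is_interval_convex_1[symmetric] intro: mem_is_interval_1_I less_imp_le)
  \<comment> \<open>If \<open>S\<close> has no point in \<open>(y, y + d)\<close>, then
    \<open>r = d\<close> works vacuously. Otherwise a single such \<open>z\<close> suffices: for
    \<open>w\<close> between \<open>y\<close> and \<open>\<xi> z\<close>, monotonicity gives
    \<open>?g y \<le> ?g w \<le> ?g (\<xi> z) < ?g y + e\<close>, so
    \<open>r = \<xi> z - y\<close>.\<close>
  have right: "\<exists>r>0. \<forall>w\<in>S. y < w \<and> w < y + r \<longrightarrow> \<bar>?g w - ?g y\<bar> < e"
  proof (cases "\<exists>z\<in>S. y < z \<and> z < y + d")
    case True
    then obtain z where z: "z \<in> S" "y < z" "z < y + d" by auto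
    have "\<bar>?g w - ?g y\<bar> < e" if "w \<in> S" "y < w" "w < \<xi> z" for w
      using mono[of y w] mono[of w "\<xi> z"] d(2)[of z] \<xi>S[of z] z that y(2) by auto
    then show ?thesis
      using \<xi>[of z] z by (intro exI[of _ "\<xi> z - y"]) auto
  qed (use d(1) in auto)
  have left: "\<exists>r>0. \<forall>w\<in>S. y - r < w \<and> w < y \<longrightarrow> \<bar>?g w - ?g y\<bar> < e"
  proof (cases "\<exists>z\<in>S. y - d < z \<and> z < y")
    case True
    then obtain z where z: "z \<in> S" "y - d < z" "z < y" by auto
    have "\<bar>?g w - ?g y\<bar> < e" if "w \<in> S" "\<xi> z < w" "w < y" for w
      using mono[of w y] mono[of "\<xi> z" w] d(2)[of z] \<xi>S[of z] z that y(2) by auto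
    then show ?thesis
      using \<xi>[of z] z by (intro exI[of _ "y - \<xi> z"]) auto
  qed (use d(1) in auto)
  from right left obtain r l where rl: "r > 0" "l > 0"
    "\<And>w. w \<in> S \<Longrightarrow> y < w \<Longrightarrow> w < y + r \<Longrightarrow> \<bar>?g w - ?g y\<bar> < e"
    "\<And>w. w \<in> S \<Longrightarrow> y - l < w \<Longrightarrow> w < y \<Longrightarrow> \<bar>?g w - ?g y\<bar> < e"
    by blast
  have "\<bar>?g w - ?g y\<bar> < e" if "w \<in> S" "w \<noteq> y" "\<bar>w - y\<bar> < min r l" for w
    using rl(3,4)[OF that(1)] that(2,3) by (cases "w < y") (auto simp: abs_if split: if_splits)
  then show "\<forall>\<^sub>F z in at y within S. dist (?g z) (?g y) < e"
    unfolding eventually_at dist_real_def using rl(1,2) by (intro exI[of _ "min r l"]) auto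
qed

section \<open>Differentiability of \<open>F\<close> and of \<open>lyapunov_fun F\<close>\<close>

text \<open>The subgradient inequalities at \<open>y\<close> and at \<open>z\<close> enclose the
  difference quotient of \<open>F\<close> between \<open>g y\<close> and \<open>g z\<close>, in an
  order that depends on the sign of \<open>z - y\<close>.\<close>

lemma has_derivative_continuous_subgradient:
  fixes F :: "real \<Rightarrow> ereal"
  assumes y: "y \<in> S" and g: "\<And>z. z \<in> S \<Longrightarrow> g z \<in> convex_subdiff S F z"
    and lim: "(g \<longlongrightarrow> g y) (at y within S)"
  shows "((\<lambda>z. real_of_ereal (F z)) has_derivative (\<lambda>h. g y * h)) (at y within S)"
proof -
  let ?F = "\<lambda>z. real_of_ereal (F z)"
  have fin: "F z = ereal (?F z)" if "z \<in> S" for z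
    using g[OF that] by (auto simp: convex_subdiff_def ereal_real)
  have sub: "?F z + g z * (w - z) \<le> ?F w" if "z \<in> S" "w \<in> S" for z w
  proof -
    have "F z + ereal (g z * (w - z)) \<le> F w"
      using g[OF that(1)] that(2) by (simp add: convex_subdiff_def)
    then show ?thesis
      using fin[OF that(1)] fin[OF that(2)] by (metis ereal_less_eq(3) plus_ereal.simps(1))
  qed
  have "(?F has_field_derivative g y) (at y within S)"
    unfolding has_field_derivative_iff
  proof (rule LIM_zero_cancel, rule Lim_null_comparison)
    have "\<bar>(?F z - ?F y) / (z - y) - g y\<bar> \<le> \<bar>g z - g y\<bar>" if "z \<in> S" "z \<noteq> y" for z
    proof -
      have "?F z - ?F y \<ge> g y * (z - y)" "?F z - ?F y \<le> g z * (z - y)"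
        using sub[OF y that(1)] sub[OF that(1) y] by (auto simp: algebra_simps)
      then have "g y \<le> (?F z - ?F y) / (z - y) \<and> (?F z - ?F y) / (z - y) \<le> g z \<or>
          g z \<le> (?F z - ?F y) / (z - y) \<and> (?F z - ?F y) / (z - y) \<le> g y"
        using that(2) by (cases "y < z") (simp_all add: pos_le_divide_eq pos_divide_le_eq
            neg_le_divide_eq neg_divide_le_eq)
      then show ?thesis by linarith
    qed
    then show "\<forall>\<^sub>F z in at y within S. norm ((?F z - ?F y) / (z - y) - g y) \<le> \<bar>g z - g y\<bar>"
      by (auto simp: eventually_at_filter)
    show "((\<lambda>z. \<bar>g z - g y\<bar>) \<longlongrightarrow> 0) (at y within S)"
      using lim by (simp add: LIM_zero tendsto_rabs_zero)
  qed
  then show ?thesis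
    by (simp add: has_field_derivative_def)
qed

lemma has_gradient_lyapunov_fun:
  fixes F :: "real \<Rightarrow> ereal"
  assumes y: "y \<in> D" and fin: "\<bar>F y\<bar> \<noteq> \<infinity>" "\<forall>\<^sub>F z in at y within D. \<bar>F z\<bar> \<noteq> \<infinity>"
    and F: "((\<lambda>z. real_of_ereal (F z)) has_derivative (\<lambda>h. g * h)) (at y within D)"
  shows "has_gradient_within (lyapunov_fun F) (g, 0) (y, 0) (D \<times> UNIV)"
proof -
  let ?F = "\<lambda>z. real_of_ereal (F z)"
  \<comment> \<open>The centre \<open>y\<close> has to be included: the points
    \<open>(y, \<rho>)\<close> with \<open>\<rho> \<noteq> 0\<close> lie in every punctured
    neighbourhood of \<open>(y, 0)\<close> and project to \<open>y\<close>.\<close>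
  have "\<forall>\<^sub>F z in nhds y. z \<in> D \<longrightarrow> \<bar>F z\<bar> \<noteq> \<infinity>"
    using fin by (auto simp: eventually_at_filter elim: eventually_mono)
  then have "\<forall>\<^sub>F p in nhds (y, 0 :: real). fst p \<in> D \<longrightarrow> \<bar>F (fst p)\<bar> \<noteq> \<infinity>"
    using filterlim_fst[of "nhds y" "nhds (0 :: real)"]
    by (auto simp: nhds_prod filterlim_iff)
  then have ev: "\<forall>\<^sub>F p in at (y, 0 :: real) within D \<times> UNIV. \<bar>F (fst p)\<bar> \<noteq> \<infinity>"
    by (auto simp: eventually_at_filter elim: eventually_mono)
  have "((\<lambda>p. ?F (fst p)) has_derivative (\<lambda>h. g * fst h)) (at (y, 0 :: real) within D \<times> UNIV)"
    by (rule has_derivative_in_compose[where f = fst and g = ?F, unfolded fst_conv])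
      (use F in \<open>auto intro!: derivative_eq_intros\<close>)
  \<comment> \<open>The derivative of \<open>\<rho>\<^sup>2 / 2\<close> vanishes at 0, hence the
    second component 0 of the gradient.\<close>
  then have "((\<lambda>p. ?F (fst p) + (snd p)\<^sup>2 / 2) has_derivative (\<lambda>h. (g, 0) \<bullet> h))
      (at (y, 0 :: real) within D \<times> UNIV)"
    by (auto intro!: derivative_eq_intros simp: inner_prod_def)
  \<comment> \<open>\<open>real_of_ereal\<close> splits the sum where \<open>F\<close> is finite; by
    \<open>ev\<close> this is the case near \<open>(y, 0)\<close>, which suffices for the
    derivative.\<close>
  moreover have real: "real_of_ereal (lyapunov_fun F p) = ?F (fst p) + (snd p)\<^sup>2 / 2"
    and finite: "\<bar>lyapunov_fun F p\<bar> \<noteq> \<infinity>" if "\<bar>F (fst p)\<bar> \<noteq> \<infinity>" for p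
    using that by (cases "F (fst p)"; auto simp: lyapunov_fun_def split_beta)+
  ultimately show ?thesis
    unfolding has_gradient_within_def
    using ev y fin(1)
    by (auto elim!: eventually_mono has_derivative_transform_eventually intro!: finite)
qed

section \<open>Gradient and subgradients of \<open>lyapunov_fun F\<close> as Newton steps\<close>

lemma newton_potentialD:
  assumes "newton_potential f D F" "y \<in> D" "0 \<notin> symmetric_subdiff f y" "ys \<in> symmetric_subdiff f y"
  shows "(f y / (norm ys)\<^sup>2) *\<^sub>R ys \<in> convex_subdiff D F y"
  using assms unfolding newton_potential_def by blast

lemma newton_step_gradient:
  fixes f :: "real \<Rightarrow> real"
  assumes N: "newton_potential f D F" and y: "y \<in> D" "0 \<notin> symmetric_subdiff f y"
    and diff: "\<And>t. f differentiable (at t)"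
  shows "has_gradient_within (lyapunov_fun F) (f y / deriv f y, 0) (y, 0) (D \<times> UNIV)"
proof -
  let ?g = "\<lambda>z. f z / deriv f z"
  have f: "(f has_real_derivative deriv f t) (at t)" for t
    using diff by (simp add: DERIV_deriv_iff_real_differentiable)
  \<comment> \<open>The constant sequence at \<open>z\<close> is the witness.\<close>
  have deriv: "deriv f z \<in> symmetric_subdiff f z" for z
    unfolding symmetric_subdiff_real[OF f] by (auto intro!: exI[of _ "\<lambda>_. z"])
  \<comment> \<open>With \<open>ys = deriv f z\<close> the prescribed subgradient is
    \<open>f z / deriv f z\<close>. In the case \<open>deriv f z = 0\<close> both expressions are 0,
    since division by 0 yields 0.\<close>
  have g: "?g z \<in> convex_subdiff D F z" if "z \<in> D" "0 \<notin> symmetric_subdiff f z" for z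
    using newton_potentialD[OF N that deriv]
    by (cases "deriv f z = 0") (simp_all add: power2_eq_square)
  obtain c where c: "c > 0" "\<And>z. z \<in> ball y c \<Longrightarrow> 0 \<notin> symmetric_subdiff f z"
    using eventually_zero_notin_symmetric_subdiff[OF f y(2)]
    by (auto simp: eventually_nhds_metric dist_commute)
  \<comment> \<open>On \<open>S\<close> the Newton step is a subgradient selection at every point.
    \<open>S\<close> is again convex and induces the same filter at \<open>y\<close> as
    \<open>D\<close>.\<close>
  define S where "S = D \<inter> ball y c"
  have S: "S \<subseteq> D" "y \<in> S" "convex S"
    using N y(1) c(1) by (auto simp: S_def newton_potential_def intro!: convex_Int)
  have gS: "?g z \<in> convex_subdiff D F z" if "z \<in> S" for z
    using g c(2) that by (auto simp: S_def)
  have at: "at y within D = at y within S"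
    by (rule at_within_nhd[of _ "ball y c"]) (use c(1) in \<open>auto simp: S_def\<close>)
  have "deriv f y \<noteq> 0"
    using deriv[of y] y(2) by auto
  then have "(?g \<longlongrightarrow> ?g y) (at y within S)"
    using S by (intro continuous_newton_step[OF f]) (auto intro: convex_subdiff_mono[OF gS gS])
  \<comment> \<open>Passing from \<open>D\<close> to \<open>S\<close> leaves fewer points at which
    to test the subgradient inequality.\<close>
  moreover have "?g z \<in> convex_subdiff S F z" if "z \<in> S" for z
    using gS[OF that] S(1) by (auto simp: convex_subdiff_def)
  ultimately have "((\<lambda>z. real_of_ereal (F z)) has_derivative (\<lambda>h. ?g y * h)) (at y within S)"
    using S(2) by (intro has_derivative_continuous_subgradient)
  moreover have fin: "\<bar>F z\<bar> \<noteq> \<infinity>" if "z \<in> S" for z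
    using gS[OF that] by (simp add: convex_subdiff_def)
  ultimately show ?thesis
    using S(2) y(1) by (intro has_gradient_lyapunov_fun) (auto simp: at eventually_at_filter)
qed

text \<open>The quadratic term is nonnegative and vanishes at 0, so 0 is a subgradient of it there;
  add the inequality for \<open>F\<close>.\<close>

lemma convex_subdiff_lyapunov_fun:
  assumes "v \<in> convex_subdiff D F y"
  shows "(v, 0) \<in> convex_subdiff (D \<times> UNIV) (lyapunov_fun F) (y, 0)"
proof -
  have "F y + ereal (v \<bullet> (z - y)) \<le> F z + ereal (\<rho>\<^sup>2 / 2)" if "z \<in> D" for z and \<rho> :: real
    using add_mono[of "F y + ereal (v \<bullet> (z - y))" "F z" 0 "ereal (\<rho>\<^sup>2 / 2)"] assms that
    by (auto simp: convex_subdiff_def)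
  then show ?thesis
    using assms by (auto simp: convex_subdiff_def lyapunov_fun_def inner_prod_def zero_ereal_def[symmetric])
qed

theorem proposition2:
  "(\<forall>(f :: real \<Rightarrow> real) (D :: real set) (F :: real \<Rightarrow> ereal) (y :: real) (x :: real \<times> real).
      continuous_on UNIV f \<longrightarrow> newton_potential f D F \<longrightarrow>
      x = (y, 0) \<longrightarrow> x \<in> D \<times> UNIV \<longrightarrow> 0 \<notin> symmetric_subdiff f y \<longrightarrow>
      (\<forall>t. f differentiable (at t)) \<longrightarrow>
      (\<exists>v. has_gradient_within (lyapunov_fun F) v x (D \<times> UNIV) \<and>
           (newton_raphson f y, 0) = x - v)) \<and>
   (\<forall>(f :: 'a::euclidean_space \<Rightarrow> real) (D :: 'a set) (F :: 'a \<Rightarrow> ereal) (y :: 'a)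
      (x :: 'a \<times> real) (ys :: 'a).
      continuous_on UNIV f \<longrightarrow> newton_potential f D F \<longrightarrow>
      x = (y, 0) \<longrightarrow> x \<in> D \<times> UNIV \<longrightarrow> 0 \<notin> symmetric_subdiff f y \<longrightarrow>
      ys \<in> symmetric_subdiff f y \<longrightarrow>
      (\<exists>xs \<in> convex_subdiff (D \<times> UNIV) (lyapunov_fun F) x.
           (y - (f y / (norm ys)\<^sup>2) *\<^sub>R ys, 0) = x - xs))"
proof (intro conjI allI impI, goal_cases)
  case (1 f D F y x)
  then show ?case
    using newton_step_gradient[of f D F y]
    \<comment> \<open>The gradient is the Newton step itself, and \<open>x\<close> has second
      component 0.\<close>
    by (intro exI[of _ "(f y / deriv f y, 0)"]) (auto simp: newton_raphson_def)
next
  case (2 f D F y x ys)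
  then show ?case
    using convex_subdiff_lyapunov_fun[OF newton_potentialD[of f D F y ys]]
    by (intro bexI[of _ "((f y / (norm ys)\<^sup>2) *\<^sub>R ys, 0)"]) auto
qed

end
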